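(* Let $G$ be a connected non-bipartite simple graph on $[n]$. Then $$\mathrm{v}_{I_{K_n}}(L_G^{\mathbb{R}}(2))\leq \gamma_{c,n}(G)=\min\{|T| : T\subseteq[n] \text{ is a dominating set of } G \text{ and } G[T] \text{ is connected and non-bipartite}\}.$$
   Context: $[n]=\{1,\dots,n\}$ and $R=\mathbb{R}[x_1,\dots,x_n,y_1,\dots,y_n]$ with the standard grading. The ideal $$L_G^{\mathbb{R}}(2)=(x_ix_j+y_iy_j:\{i,j\}\in E(G))\subset R$$ is the Lovász–Saks–Schrijver ideal of $G$ in dimension $2$ over $\mathbb{R}$. $I_{K_n}\subset R$ is the ideal generated by $x_ix_j+y_iy_j$ and $x_iy_j-x_jy_i$ for $1\le i<j\le n$, and $x_i^2+y_i^2$ for $1\le i\le n$; for $G$ connected and non-bipartite it is a minimal prime of $L_G^{\mathbb{R}}(2)$. $T\subseteq[n]$ is a dominating (dominant) set of $G$ if every vertex of $[n]\setminus T$ is adjacent to some vertex of $T$. $G[T]$ is the induced subgraph on $T$. For a graded ideal $I\subset R$ and $\mathfrak p\in\mathrm{Ass}(I)$, $\mathrm{v}_{\mathfrak p}(I)=\min\{d\ge 0:\exists f\in R_d \text{ with } I:f=\mathfrak p\}$. *)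

theory Defs
  imports
    Complex_Main
    "HOL-Library.Poly_Mapping"
    "HOL-Library.Extended_Nat"
    "HOL-Algebra.Ideal"
    "Graph_Theory.Graph_Theory"
begin

section \<open>Polynomial rings\<close>

text \<open>
  A polynomial is a finitely supported map from monomials to coefficients; a monomial is a
  finitely supported map from variables to exponents. The ring operations are those of the
  type, so the polynomial ring in the variables \<open>V\<close> is the subset of polynomials in which
  only variables from \<open>V\<close> occur.
\<close>

type_synonym ('v, 'a) mpoly = "('v \<Rightarrow>\<^sub>0 nat) \<Rightarrow>\<^sub>0 'a"

definition Var :: "'v \<Rightarrow> ('v, 'a::zero_neq_one) mpoly" where
  "Var v = Poly_Mapping.single (Poly_Mapping.single v 1) 1"

definition poly_ring :: "'v set \<Rightarrow> ('v, 'a::comm_ring_1) mpoly ring" where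
  "poly_ring V =
    \<lparr>carrier = {p. \<forall>m \<in> Poly_Mapping.keys p. Poly_Mapping.keys m \<subseteq> V},
     monoid.mult = (*), one = 1, zero = 0, add = (+)\<rparr>"

definition monom_degree :: "('v \<Rightarrow>\<^sub>0 nat) \<Rightarrow> nat" where
  "monom_degree m = (\<Sum>v \<in> Poly_Mapping.keys m. Poly_Mapping.lookup m v)"

text \<open>The homogeneous component of degree \<open>d\<close>; it contains \<open>0\<close>.\<close>

definition graded_part :: "('v, 'a::zero) mpoly ring \<Rightarrow> nat \<Rightarrow> ('v, 'a) mpoly set" where
  "graded_part R d = {f \<in> carrier R. \<forall>m \<in> Poly_Mapping.keys f. monom_degree m = d}"

lemma poly_ring_simps [simp]:
  "p \<in> carrier (poly_ring V) \<longleftrightarrow>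
    (\<forall>m \<in> Poly_Mapping.keys p. Poly_Mapping.keys m \<subseteq> V)"
  "p \<otimes>\<^bsub>poly_ring V\<^esub> q = p * q"
  "p \<oplus>\<^bsub>poly_ring V\<^esub> q = p + q"
  "\<one>\<^bsub>poly_ring V\<^esub> = 1"
  "\<zero>\<^bsub>poly_ring V\<^esub> = 0"
  by (simp_all add: poly_ring_def)

lemma cring_poly_ring: "cring (poly_ring V :: ('v, 'a::comm_ring_1) mpoly ring)"
proof (rule cringI)
  show "abelian_group (poly_ring V :: ('v, 'a) mpoly ring)"
  proof (rule abelian_groupI)
    fix x y :: "('v, 'a) mpoly"
    assume "x \<in> carrier (poly_ring V)" "y \<in> carrier (poly_ring V)"
    then show "x \<oplus>\<^bsub>poly_ring V\<^esub> y \<in> carrier (poly_ring V)"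
      using keys_add[of x y] by (auto; blast)
  next
    fix x :: "('v, 'a) mpoly"
    assume "x \<in> carrier (poly_ring V)"
    then show "\<exists>y \<in> carrier (poly_ring V). y \<oplus>\<^bsub>poly_ring V\<^esub> x = \<zero>\<^bsub>poly_ring V\<^esub>"
      by (intro bexI[of _ "- x"]) (auto simp: in_keys_iff)
  qed (auto simp: algebra_simps)
next
  show "Group.comm_monoid (poly_ring V :: ('v, 'a) mpoly ring)"
  proof (rule comm_monoidI)
    fix x y :: "('v, 'a) mpoly"
    assume xy: "x \<in> carrier (poly_ring V)" "y \<in> carrier (poly_ring V)"
    show "x \<otimes>\<^bsub>poly_ring V\<^esub> y \<in> carrier (poly_ring V)"
      unfolding poly_ring_simps
    proof
      fix m assume "m \<in> Poly_Mapping.keys (x * y)"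
      then obtain a b where "m = a + b"
        "a \<in> Poly_Mapping.keys x" "b \<in> Poly_Mapping.keys y"
        using keys_mult[of x y] by blast
      then show "Poly_Mapping.keys m \<subseteq> V"
        using xy keys_add[of a b] by (auto; blast)
    qed
  qed (auto simp: algebra_simps)
qed (auto simp: algebra_simps)


section \<open>Colon ideals and v-numbers\<close>

definition colon_ideal :: "('a, 'b) ring_scheme \<Rightarrow> 'a set \<Rightarrow> 'a \<Rightarrow> 'a set" where
  "colon_ideal R I f = {g \<in> carrier R. g \<otimes>\<^bsub>R\<^esub> f \<in> I}"

text \<open>
  For an associated prime \<open>P\<close> of a graded ideal \<open>I\<close> the infimum below is a minimum. It is
  \<open>\<infinity>\<close> precisely if no homogeneous \<open>f\<close> satisfies \<open>I : f = P\<close>; in particular, a finite upper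
  bound on it includes the existence of such an \<open>f\<close>.
\<close>

definition v_number ::
    "('v, 'a::zero) mpoly ring \<Rightarrow> ('v, 'a) mpoly set \<Rightarrow> ('v, 'a) mpoly set \<Rightarrow> enat" where
  "v_number R P I = (INF d \<in> {d. \<exists>f \<in> graded_part R d. colon_ideal R I f = P}. enat d)"


section \<open>Lovasz--Saks--Schrijver ideals in dimension 2\<close>

datatype lss_var = X nat | Y nat

definition lss_ring :: "nat \<Rightarrow> (lss_var, real) mpoly ring" where
  "lss_ring n = poly_ring (X ` {1..n} \<union> Y ` {1..n})"

abbreviation xv :: "nat \<Rightarrow> (lss_var, real) mpoly" where "xv i \<equiv> Var (X i)"
abbreviation yv :: "nat \<Rightarrow> (lss_var, real) mpoly" where "yv i \<equiv> Var (Y i)"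

text \<open>
  A simple graph is a \<^locale>\<open>pair_graph\<close>: each edge \<open>{i, j}\<close> is represented by both arcs
  \<open>(i, j)\<close> and \<open>(j, i)\<close>, which yield the same generator below.
\<close>

definition lss_ideal :: "nat \<Rightarrow> nat pair_pre_digraph \<Rightarrow> (lss_var, real) mpoly set" where
  "lss_ideal n G = Idl\<^bsub>lss_ring n\<^esub> {xv i * xv j + yv i * yv j | i j. (i, j) \<in> parcs G}"

definition I_K :: "nat \<Rightarrow> (lss_var, real) mpoly set" where
  "I_K n = Idl\<^bsub>lss_ring n\<^esub>
    ({xv i * xv j + yv i * yv j | i j. 1 \<le> i \<and> i < j \<and> j \<le> n} \<union>
     {xv i * yv j - xv j * yv i | i j. 1 \<le> i \<and> i < j \<and> j \<le> n} \<union>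
     {(xv i)\<^sup>2 + (yv i)\<^sup>2 | i. 1 \<le> i \<and> i \<le> n})"


section \<open>Domination\<close>

definition bipartite :: "('a, 'b) pre_digraph \<Rightarrow> bool" where
  "bipartite G \<longleftrightarrow>
    (\<exists>A B. verts G = A \<union> B \<and> A \<inter> B = {} \<and> arcs_ends G \<subseteq> A \<times> B \<union> B \<times> A)"

definition dominating_set :: "('a, 'b) pre_digraph \<Rightarrow> 'a set \<Rightarrow> bool" where
  "dominating_set G T \<longleftrightarrow>
    T \<subseteq> verts G \<and> (\<forall>v \<in> verts G - T. \<exists>u \<in> T. (v, u) \<in> arcs_ends G)"

definition conn_nonbip_dominating_sets :: "('a, 'b) pre_digraph \<Rightarrow> 'a set set" where
  "conn_nonbip_dominating_sets G =
    {T. dominating_set G T \<and>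
        Digraph_Component.connected (G \<restriction> T) \<and> \<not> bipartite (G \<restriction> T)}"

definition gamma_cn :: "('a, 'b) pre_digraph \<Rightarrow> nat" where
  "gamma_cn G = Min (card ` conn_nonbip_dominating_sets G)"

text \<open>The minimum is over a finite nonempty set for the graphs under consideration.\<close>

lemma finite_conn_nonbip_dominating_sets:
  "finite (verts G) \<Longrightarrow> finite (conn_nonbip_dominating_sets G)"
  by (rule finite_subset[of _ "Pow (verts G)"])
     (auto simp: conn_nonbip_dominating_sets_def dominating_set_def)

lemma verts_in_conn_nonbip_dominating_sets:
  assumes "wf_digraph G" "Digraph_Component.connected G" "\<not> bipartite G"
  shows "verts G \<in> conn_nonbip_dominating_sets G"
proof -
  interpret wf_digraph G by fact
  have "G \<restriction> verts G = G"
    by (auto simp: induce_subgraph_def intro!: pre_digraph.equality)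
  then show ?thesis
    using assms by (simp add: conn_nonbip_dominating_sets_def dominating_set_def)
qed

end

theory Submission
  imports Defs
begin

text \<open>
  Over the complex numbers put \<open>z\<^sub>j = x\<^sub>j + i y\<^sub>j\<close> and \<open>w\<^sub>j = x\<^sub>j - i y\<^sub>j\<close>. The generators of the
  Lovasz--Saks--Schrijver ideal \<open>L\<close> become \<open>z\<^sub>i w\<^sub>j + w\<^sub>i z\<^sub>j\<close> up to a factor, and \<open>I_K\<close> becomes
  \<open>(z\<^sub>i w\<^sub>j : i, j) = (z\<^sub>1, \<dots>, z\<^sub>n) \<inter> (w\<^sub>1, \<dots>, w\<^sub>n)\<close>. For \<open>T\<close> as in the theorem let \<open>F\<close> be the product
  of the \<open>z\<^sub>t\<close>, \<open>t \<in> T\<close>; its real part \<open>f\<close> satisfies \<open>L : f = I_K\<close>.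

  Let \<open>N\<^sub>j\<close> arise from \<open>F\<close> by replacing \<open>z\<^sub>j\<close> with \<open>w\<^sub>j\<close>. Modulo \<open>L\<close>, \<open>N\<^sub>j\<close> changes sign along every
  edge of \<open>G[T]\<close>; as \<open>G[T]\<close> is connected and not bipartite, all \<open>N\<^sub>j\<close> lie in \<open>L\<close>. Domination then
  gives \<open>w\<^sub>k F \<in> L\<close> for every vertex \<open>k\<close>, and conjugation gives the same for \<open>z\<^sub>k\<close> and the conjugate
  of \<open>F\<close>, whence \<open>f I_K \<subseteq> L\<close>. Conversely, the two substitutions \<open>w = 0\<close> and \<open>z = 0\<close> kill \<open>L\<close> but
  not \<open>f\<close>, and a real polynomial that both of them kill belongs to \<open>I_K\<close>.
\<close>

section \<open>Evaluation homomorphisms and complexification\<close>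

text \<open>The library makes \<open>(v \<Rightarrow>\<^sub>0 nat) \<Rightarrow>\<^sub>0 complex\<close> an integral domain only for linearly ordered \<open>v\<close>.\<close>

instantiation lss_var :: linorder
begin

fun lss_code :: "lss_var \<Rightarrow> nat" where
  "lss_code (X i) = 2 * i"
| "lss_code (Y i) = 2 * i + 1"

definition "u \<le> v \<longleftrightarrow> lss_code u \<le> lss_code v"
definition "u < v \<longleftrightarrow> lss_code u < lss_code v"

instance
proof
  fix u v :: lss_var
  assume "u \<le> v" "v \<le> u"
  then have "lss_code u = lss_code v"
    by (simp add: less_eq_lss_var_def)
  then show "u = v"
    by (cases u; cases v; simp; presburger)
qed (auto simp: less_eq_lss_var_def less_lss_var_def)

end

abbreviation Const :: "'a \<Rightarrow> ('v, 'a::zero) mpoly" where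
  "Const \<equiv> Poly_Mapping.single 0"

lemma Const_mult: "Const (a * b) = Const a * (Const b :: ('v, 'a::comm_semiring_1) mpoly)"
  by (simp add: mult_single)

lemma lookup_Const_mult:
  fixes q :: "('v, 'a::semiring_0) mpoly"
  shows "Poly_Mapping.lookup (Const c * q) m = c * Poly_Mapping.lookup q m"
proof -
  have "Const c * q = Poly_Mapping.map ((*) c) q"
    by (simp add: mult_map_scale_conv_mult)
  then show ?thesis
    by (simp add: Poly_Mapping.map.rep_eq when_def)
qed

lemma poly_mapping_eq_sum_single:
  fixes p :: "'m \<Rightarrow>\<^sub>0 'a::comm_monoid_add"
  assumes "finite A" "Poly_Mapping.keys p \<subseteq> A"
  shows "p = (\<Sum>m\<in>A. Poly_Mapping.single m (Poly_Mapping.lookup p m))"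
  using assms
  by (intro poly_mapping_eqI)
     (auto simp: lookup_sum lookup_single when_def in_keys_iff sum.delta)

definition monom_eval :: "('v \<Rightarrow> 'r::comm_monoid_mult) \<Rightarrow> ('v \<Rightarrow>\<^sub>0 nat) \<Rightarrow> 'r" where
  "monom_eval h m = (\<Prod>v\<in>Poly_Mapping.keys m. h v ^ Poly_Mapping.lookup m v)"

lemma monom_eval_superset:
  assumes "finite A" "Poly_Mapping.keys m \<subseteq> A"
  shows "monom_eval h m = (\<Prod>v\<in>A. h v ^ Poly_Mapping.lookup m v)"
  unfolding monom_eval_def
  by (rule prod.mono_neutral_left) (use assms in \<open>auto simp: in_keys_iff\<close>)

lemma monom_eval_0 [simp]: "monom_eval h 0 = 1"
  by (simp add: monom_eval_def)

lemma monom_eval_single [simp]: "monom_eval h (Poly_Mapping.single v k) = h v ^ k"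
  by (subst monom_eval_superset[of "{v}"]) auto

lemma monom_eval_add: "monom_eval h (m + m') = monom_eval h m * monom_eval h m'"
proof -
  let ?A = "Poly_Mapping.keys m \<union> Poly_Mapping.keys m'"
  have "Poly_Mapping.keys (m + m') \<subseteq> ?A"
    by (rule keys_add)
  then show ?thesis
    by (simp add: monom_eval_superset[of ?A] lookup_add power_add prod.distrib)
qed

lemma monom_eval_Var:
  "monom_eval Var m = (Poly_Mapping.single m 1 :: ('v, 'a::comm_semiring_1) mpoly)"
proof -
  have pow: "(Var v :: ('v, 'a) mpoly) ^ k = Poly_Mapping.single (Poly_Mapping.single v k) 1"
    for v k
    by (induction k) (simp_all add: Var_def mult_single flip: single_add)
  have "(\<Prod>v\<in>A. Poly_Mapping.single (g v) (1::'a)) = Poly_Mapping.single (\<Sum>v\<in>A. g v) 1"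
    if "finite A" for A and g :: "'v \<Rightarrow> 'v \<Rightarrow>\<^sub>0 nat"
    using that by (induction A) (simp_all add: mult_single)
  then show ?thesis
    unfolding monom_eval_def pow
    using poly_mapping_eq_sum_single[of "Poly_Mapping.keys m" m] by simp
qed

text \<open>Coefficient extension and substitution are done in one map, so that complexification and
  the two substitutions into isotropic coordinates are instances of a single ring
  homomorphism.\<close>

definition eval_mpoly ::
    "('v \<Rightarrow> ('w, complex) mpoly) \<Rightarrow> ('v, real) mpoly \<Rightarrow> ('w, complex) mpoly" where
  "eval_mpoly h p = (\<Sum>m\<in>Poly_Mapping.keys p.
     Const (of_real (Poly_Mapping.lookup p m)) * monom_eval h m)"

lemma eval_mpoly_superset:
  assumes "finite A" "Poly_Mapping.keys p \<subseteq> A"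
  shows "eval_mpoly h p =
    (\<Sum>m\<in>A. Const (of_real (Poly_Mapping.lookup p m)) * monom_eval h m)"
  unfolding eval_mpoly_def
  by (rule sum.mono_neutral_left) (use assms in \<open>auto simp: in_keys_iff\<close>)

lemma eval_mpoly_0 [simp]: "eval_mpoly h 0 = 0"
  by (simp add: eval_mpoly_def)

lemma eval_mpoly_single:
  "eval_mpoly h (Poly_Mapping.single m c) = Const (of_real c) * monom_eval h m"
  by (subst eval_mpoly_superset[of "{m}"]) auto

lemma eval_mpoly_1 [simp]: "eval_mpoly h 1 = 1"
  using eval_mpoly_single[of h 0 1] by simp

lemma eval_mpoly_Const: "eval_mpoly h (Const c) = Const (of_real c)"
  by (simp add: eval_mpoly_single)

lemma eval_mpoly_Var [simp]: "eval_mpoly h (Var v) = h v"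
  by (simp add: Var_def eval_mpoly_single)

lemma eval_mpoly_add [simp]: "eval_mpoly h (p + q) = eval_mpoly h p + eval_mpoly h q"
proof -
  let ?A = "Poly_Mapping.keys p \<union> Poly_Mapping.keys q"
  have "Poly_Mapping.keys (p + q) \<subseteq> ?A"
    by (rule keys_add)
  then show ?thesis
    by (simp add: eval_mpoly_superset[of ?A] lookup_add single_add ring_distribs sum.distrib)
qed

lemma eval_mpoly_minus [simp]: "eval_mpoly h (- p) = - eval_mpoly h p"
  using eval_mpoly_add[of h p "- p"] by (simp add: eq_neg_iff_add_eq_0 add.commute)

lemma eval_mpoly_diff [simp]: "eval_mpoly h (p - q) = eval_mpoly h p - eval_mpoly h q"
  using eval_mpoly_add[of h p "- q"] by simp

lemma eval_mpoly_sum: "eval_mpoly h (sum f A) = (\<Sum>x\<in>A. eval_mpoly h (f x))"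
  by (induction A rule: infinite_finite_induct) simp_all

lemma eval_mpoly_mult [simp]: "eval_mpoly h (p * q) = eval_mpoly h p * eval_mpoly h q"
proof -
  let ?P = "Poly_Mapping.keys p" and ?Q = "Poly_Mapping.keys q"
  let ?p = "Poly_Mapping.lookup p" and ?q = "Poly_Mapping.lookup q"
  have "p * q = (\<Sum>m\<in>?P. Poly_Mapping.single m (?p m)) * (\<Sum>m\<in>?Q. Poly_Mapping.single m (?q m))"
    by (simp flip: poly_mapping_eq_sum_single)
  also have "\<dots> = (\<Sum>m\<in>?P. \<Sum>m'\<in>?Q. Poly_Mapping.single (m + m') (?p m * ?q m'))"
    by (simp add: sum_product mult_single)
  finally have "eval_mpoly h (p * q) =
      (\<Sum>m\<in>?P. \<Sum>m'\<in>?Q. Const (of_real (?p m * ?q m')) * monom_eval h (m + m'))"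
    by (simp only: eval_mpoly_sum eval_mpoly_single)
  also have "\<dots> = eval_mpoly h p * eval_mpoly h q"
    by (simp add: eval_mpoly_def sum_product monom_eval_add Const_mult mult_ac)
  finally show ?thesis .
qed

section \<open>Complexification and complex spans of real ideals\<close>

abbreviation complexify :: "('v, real) mpoly \<Rightarrow> ('v, complex) mpoly" where
  "complexify \<equiv> eval_mpoly Var"

lemma lookup_complexify:
  "Poly_Mapping.lookup (complexify p) m = of_real (Poly_Mapping.lookup p m)"
proof -
  have "complexify p =
      (\<Sum>m\<in>Poly_Mapping.keys p. Poly_Mapping.single m (of_real (Poly_Mapping.lookup p m)))"
    by (simp add: eval_mpoly_def monom_eval_Var mult_single)
  then show ?thesis
    by (simp add: lookup_sum lookup_single when_def sum.delta in_keys_iff)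
qed

text \<open>For a real ideal \<open>J\<close> this is its extension of scalars
  \<open>J + i J\<close>. For the carrier it is the complex polynomial ring in the same
  variables.\<close>

definition cspan :: "('v, real) mpoly set \<Rightarrow> ('v, complex) mpoly set" where
  "cspan J = {complexify a + Const \<i> * complexify b | a b. a \<in> J \<and> b \<in> J}"

text \<open>Comparing real parts of coefficients gives \<open>p = a\<close>. Memberships may thus be
  computed over the complex numbers and pulled back.\<close>

lemma complexify_in_cspanD:
  assumes "complexify p \<in> cspan J"
  shows "p \<in> J"
proof -
  obtain a b where ab: "complexify p = complexify a + Const \<i> * complexify b" "a \<in> J"
    using assms by (auto simp: cspan_def)
  have "complex_of_real (Poly_Mapping.lookup p m) =
      of_real (Poly_Mapping.lookup a m) + \<i> * of_real (Poly_Mapping.lookup b m)" for m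
    using arg_cong[OF ab(1), of "\<lambda>q. Poly_Mapping.lookup q m"]
    by (simp add: lookup_add lookup_complexify lookup_Const_mult)
  from this[THEN arg_cong[where f = Re]]
  have "Poly_Mapping.lookup p m = Poly_Mapping.lookup a m" for m
    by simp
  then have "p = a"
    by (rule poly_mapping_eqI)
  with ab show ?thesis by simp
qed

lemma ideal_poly_ring:
  fixes J :: "('v, 'a::comm_ring_1) mpoly set"
  assumes "ideal J (poly_ring V)"
  shows "0 \<in> J" and "\<And>a b. a \<in> J \<Longrightarrow> b \<in> J \<Longrightarrow> a + b \<in> J" and "\<And>a. a \<in> J \<Longrightarrow> - a \<in> J"
    and "\<And>a b. a \<in> J \<Longrightarrow> b \<in> J \<Longrightarrow> a - b \<in> J"
    and "\<And>c a. c \<in> carrier (poly_ring V) \<Longrightarrow> a \<in> J \<Longrightarrow> c * a \<in> J"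
proof -
  interpret ideal J "poly_ring V" by fact
  show "0 \<in> J" using additive_subgroup.zero_closed[OF additive_subgroup_axioms] by simp
  show add: "a + b \<in> J" if "a \<in> J" "b \<in> J" for a b
    using additive_subgroup.a_closed[OF additive_subgroup_axioms that] by simp
  show mult: "c * a \<in> J" if "c \<in> carrier (poly_ring V)" "a \<in> J" for c a
    using I_l_closed[OF that(2) that(1)] by simp
  show minus: "- a \<in> J" if "a \<in> J" for a
  proof -
    have "- 1 \<in> carrier (poly_ring V :: ('v, 'a) mpoly ring)"
      by (auto simp: in_keys_iff lookup_one when_def)
    from mult[OF this that] show ?thesis by simp
  qed
  show "a - b \<in> J" if "a \<in> J" "b \<in> J" for a b
    using add[OF that(1) minus[OF that(2)]] by simp
qed

lemma ideal_carrier_poly_ring: "ideal (carrier (poly_ring V)) (poly_ring V :: ('v, 'a::comm_ring_1) mpoly ring)"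
proof -
  interpret cring "poly_ring V :: ('v, 'a) mpoly ring"
    by (rule cring_poly_ring)
  show ?thesis by (rule oneideal)
qed

lemma Const_in_carrier: "Const c \<in> carrier (poly_ring V :: ('v, 'a::comm_ring_1) mpoly ring)"
  by auto

lemma Var_in_carrier: "v \<in> V \<Longrightarrow> Var v \<in> carrier (poly_ring V :: ('v, 'a::comm_ring_1) mpoly ring)"
  by (auto simp: Var_def)

lemma Const_i_square: "Const \<i> * Const \<i> = (- 1 :: ('v, complex) mpoly)"
  by (simp add: mult_single single_uminus)

lemma cspanI: "a \<in> J \<Longrightarrow> b \<in> J \<Longrightarrow> complexify a + Const \<i> * complexify b \<in> cspan J"
  unfolding cspan_def by blast

lemma cspanE:
  assumes "p \<in> cspan J"
  obtains a b where "p = complexify a + Const \<i> * complexify b" "a \<in> J" "b \<in> J"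
  using assms unfolding cspan_def by blast

lemma cspan_add:
  assumes "ideal J (poly_ring V)" "p \<in> cspan J" "q \<in> cspan J"
  shows "p + q \<in> cspan J"
proof -
  from assms(2) obtain a b where p: "p = complexify a + Const \<i> * complexify b" "a \<in> J" "b \<in> J"
    by (rule cspanE)
  from assms(3) obtain c d where q: "q = complexify c + Const \<i> * complexify d" "c \<in> J" "d \<in> J"
    by (rule cspanE)
  have "p + q = complexify (a + c) + Const \<i> * complexify (b + d)"
    by (simp add: p q algebra_simps)
  then show ?thesis
    using cspanI ideal_poly_ring(2)[OF assms(1)] p(2,3) q(2,3) by metis
qed

lemma cspan_mult:
  assumes "ideal J (poly_ring V)" "p \<in> cspan (carrier (poly_ring V))" "q \<in> cspan J"
  shows "p * q \<in> cspan J"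
proof -
  from assms(2) obtain a b where p: "p = complexify a + Const \<i> * complexify b"
    "a \<in> carrier (poly_ring V)" "b \<in> carrier (poly_ring V)"
    by (rule cspanE)
  from assms(3) obtain c d where q: "q = complexify c + Const \<i> * complexify d" "c \<in> J" "d \<in> J"
    by (rule cspanE)
  \<comment> \<open>The defect \<open>1 + Const \<i> * Const \<i>\<close> is kept as a separate
    factor: the identity then holds in every commutative ring, and only afterwards is the factor set
    to zero.\<close>
  have "p * q = complexify (a * c - b * d) + Const \<i> * complexify (a * d + b * c)
      + (1 + Const \<i> * Const \<i>) * complexify (b * d)"
    by (simp add: p(1) q(1) algebra_simps)
  then have eq: "p * q = complexify (a * c - b * d) + Const \<i> * complexify (a * d + b * c)"
    by (simp only: Const_i_square) simp
  have "a * c - b * d \<in> J" "a * d + b * c \<in> J"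
    using ideal_poly_ring(2,4,5)[OF assms(1)] p(2,3) q(2,3) by (simp_all del: poly_ring_simps(1))
  then show ?thesis
    unfolding eq by (rule cspanI)
qed

lemma complexify_in_cspan:
  assumes "ideal J (poly_ring V)" "a \<in> J"
  shows "complexify a \<in> cspan J"
proof -
  have "complexify a = complexify a + Const \<i> * complexify 0" by simp
  then show ?thesis
    using assms(2) ideal_poly_ring(1)[OF assms(1)] cspanI by metis
qed

lemma Const_in_cspan: "Const c \<in> cspan (carrier (poly_ring V))"
proof -
  have "(Const c :: ('a, complex) mpoly) =
      complexify (Const (Re c)) + Const \<i> * complexify (Const (Im c))"
    by (simp add: eval_mpoly_Const mult_single flip: single_add complex_eq)
  then show ?thesis
    using cspanI[OF Const_in_carrier Const_in_carrier] by metis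
qed

lemma cspan_minus:
  assumes "ideal J (poly_ring V)" "p \<in> cspan J"
  shows "- p \<in> cspan J"
  using cspan_mult[OF assms(1) Const_in_cspan[of "- 1"] assms(2)] by (simp add: single_uminus)

lemma cspan_diff:
  assumes "ideal J (poly_ring V)" "p \<in> cspan J" "q \<in> cspan J"
  shows "p - q \<in> cspan J"
  using cspan_add[OF assms(1,2) cspan_minus[OF assms(1,3)]] by simp

lemma cspan_sum:
  assumes "ideal J (poly_ring V)" "\<And>x. x \<in> A \<Longrightarrow> f x \<in> cspan J"
  shows "sum f A \<in> cspan J"
  using assms(2)
proof (induction A rule: infinite_finite_induct)
  case (insert x A)
  then show ?case by (simp add: cspan_add[OF assms(1)])
qed (use complexify_in_cspan[OF assms(1) ideal_poly_ring(1)[OF assms(1)]] in auto)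

lemma cspan_halve:
  assumes "ideal J (poly_ring V)" "p + p \<in> cspan J"
  shows "p \<in> cspan J"
proof -
  have "Const (1 / 2) * (p + p) = Const (1 / 2 + 1 / 2) * p"
    by (simp only: single_add ring_distribs)
  then show ?thesis
    using cspan_mult[OF assms(1) Const_in_cspan[of "1 / 2"] assms(2)] by simp
qed

lemma cspan_prod:
  assumes "\<And>x. x \<in> A \<Longrightarrow> f x \<in> cspan (carrier (poly_ring V))"
  shows "prod f A \<in> cspan (carrier (poly_ring V))"
  using assms
proof (induction A rule: infinite_finite_induct)
  case (insert x A)
  then show ?case by (simp add: cspan_mult[OF ideal_carrier_poly_ring])
qed (use Const_in_cspan[of 1 V] in auto)

section \<open>Alternating labellings of non-bipartite graphs\<close>

text \<open>\<open>M\<close> is a subgroup in which 2 can be cancelled. If \<open>N v\<close> were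
  outside \<open>M\<close>, connectedness would make every \<open>N u\<close> congruent to exactly
  one of \<open>N v\<close> and \<open>- N v\<close>, and the sign would be a proper
  2-colouring.\<close>

lemma nonbipartite_alternating:
  fixes N :: "'a \<Rightarrow> 'b::ab_group_add"
  assumes "wf_digraph H" and conn: "Digraph_Component.connected H" and nonbip: "\<not> bipartite H"
    and zero: "0 \<in> M" and diff: "\<And>a b. a \<in> M \<Longrightarrow> b \<in> M \<Longrightarrow> a - b \<in> M"
    and halve: "\<And>a. a + a \<in> M \<Longrightarrow> a \<in> M"
    and arc: "\<And>u v. (u, v) \<in> arcs_ends H \<Longrightarrow> N u + N v \<in> M"
    and v: "v \<in> verts H"
  shows "N v \<in> M"
proof (rule ccontr)
  assume nv: "N v \<notin> M"
  interpret wf_digraph H by fact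
  define A where "A = {u \<in> verts H. N u - N v \<in> M}"
  define B where "B = {u \<in> verts H. N u + N v \<in> M}"
  \<comment> \<open>Connectedness concerns the symmetric closure; the hypothesis on arcs is
    symmetric in its two ends.\<close>
  have arc': "N u + N w \<in> M" if "(u, w) \<in> arcs_ends (mk_symmetric H)" for u w
  proof -
    have "(u, w) \<in> arcs_ends H \<or> (w, u) \<in> arcs_ends H"
      using that by (auto simp: mk_symmetric_def arcs_ends_def arc_to_ends_def)
    then show ?thesis
      using arc by (metis add.commute)
  qed
  \<comment> \<open>Crossing an edge reverses the sign.\<close>
  have flip: "(N u - N v \<in> M \<longrightarrow> N w + N v \<in> M) \<and> (N u + N v \<in> M \<longrightarrow> N w - N v \<in> M)"
    if "N u + N w \<in> M" for u w
    using diff[OF that, of "N u - N v"] diff[OF that, of "N u + N v"] by (simp add: algebra_simps)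
  have "N u - N v \<in> M \<or> N u + N v \<in> M" if "u \<in> verts H" for u
  proof -
    have "(v, u) \<in> rtrancl_on (verts H) (arcs_ends (mk_symmetric H))"
      using conn v that
      by (simp add: connected_def strongly_connected_def mk_symmetric_def reachable_def)
    then show ?thesis
    proof (induction rule: rtrancl_on_induct)
      case base
      show ?case using zero by simp
    next
      case (step y z)
      then show ?case
        using flip[OF arc'[of y z]] by blast
    qed
  qed
  then have "verts H = A \<union> B"
    by (auto simp: A_def B_def)
  moreover have "A \<inter> B = {}"
  proof -
    have False if "N u - N v \<in> M" "N u + N v \<in> M" for u
    proof -
      \<comment> \<open>A vertex with both signs would put twice \<open>N v\<close> into
        \<open>M\<close>.\<close>
      have "N v + N v = (N u + N v) - (N u - N v)"
        by (simp add: algebra_simps)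
      then have "N v + N v \<in> M"
        using diff[OF that(2,1)] by simp
      with halve nv show False by blast
    qed
    then show ?thesis
      unfolding A_def B_def by blast
  qed
  moreover have "arcs_ends H \<subseteq> A \<times> B \<union> B \<times> A"
  proof (rule subrelI)
    fix u w assume uw: "(u, w) \<in> arcs_ends H"
    then have w: "w \<in> verts H" and "u \<in> A \<union> B"
      using adj_in_verts \<open>verts H = A \<union> B\<close> by blast+
    from this(2) show "(u, w) \<in> A \<times> B \<union> B \<times> A"
    proof
      assume "u \<in> A"
      then show ?thesis
        using flip[OF arc[OF uw]] w by (simp add: A_def B_def)
    next
      assume "u \<in> B"
      then show ?thesis
        using flip[OF arc[OF uw]] w by (simp add: A_def B_def)
    qed
  qed
  ultimately show False
    using nonbip by (auto simp: bipartite_def)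
qed

section \<open>Isotropic coordinates\<close>

text \<open>For \<open>s = i\<close> this is \<open>z\<^sub>j\<close> and for \<open>s = - i\<close> it is \<open>w\<^sub>j\<close>.\<close>

definition zc :: "complex \<Rightarrow> nat \<Rightarrow> (lss_var, complex) mpoly" where
  "zc s j = Var (X j) + Const s * Var (Y j)"

lemma Const_square_minus_1: "s * s = - 1 \<Longrightarrow> Const s * Const s = (- 1 :: (lss_var, complex) mpoly)"
  by (simp add: mult_single single_uminus)

text \<open>The coefficient of \<open>X j\<close> is 1. In an integral domain products of such forms
  are then nonzero too.\<close>

lemma zc_nonzero: "zc s j \<noteq> 0"
proof
  assume "zc s j = 0"
  then have "Poly_Mapping.lookup (zc s j) (Poly_Mapping.single (X j) 1) = 0"
    by simp
  moreover have "Poly_Mapping.single (Y j) (Suc 0) \<noteq> Poly_Mapping.single (X j) (Suc 0)"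
    by (metis keys_single lss_var.distinct(1) nat.distinct(1) singleton_inject)
  ultimately show False
    by (simp add: zc_def lookup_add lookup_Const_mult)
       (simp add: Var_def lookup_single when_def)
qed

section \<open>Degrees and homogeneous parts\<close>

lemma monom_degree_superset:
  assumes "finite A" "Poly_Mapping.keys m \<subseteq> A"
  shows "monom_degree m = (\<Sum>v\<in>A. Poly_Mapping.lookup m v)"
  unfolding monom_degree_def
  by (rule sum.mono_neutral_left) (use assms in \<open>auto simp: in_keys_iff\<close>)

lemma monom_degree_add: "monom_degree (m + m') = monom_degree m + monom_degree m'"
proof -
  let ?A = "Poly_Mapping.keys m \<union> Poly_Mapping.keys m'"
  have "Poly_Mapping.keys (m + m') \<subseteq> ?A"
    by (rule keys_add)
  then show ?thesis
    by (simp add: monom_degree_superset[of ?A] lookup_add sum.distrib)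
qed

lemma monom_degree_single: "monom_degree (Poly_Mapping.single v k) = k"
  by (subst monom_degree_superset[of "{v}"]) auto

lemma monom_induct [consumes 1, case_names zero add]:
  fixes m :: "'v \<Rightarrow>\<^sub>0 nat"
  assumes "Poly_Mapping.keys m \<subseteq> V" and "P 0"
    and add: "\<And>m v. Poly_Mapping.keys m \<subseteq> V \<Longrightarrow> v \<in> V \<Longrightarrow> P m \<Longrightarrow> P (m + Poly_Mapping.single v 1)"
  shows "P m"
  using assms(1)
proof (induction "monom_degree m" arbitrary: m rule: less_induct)
  case less
  show ?case
  proof (cases "m = 0")
    case False
    then obtain v where v: "v \<in> Poly_Mapping.keys m"
      using keys_eq_empty by blast
    \<comment> \<open>Subtraction of exponents is truncated, but \<open>v\<close> occurs in
      \<open>m\<close>, so adding it back restores \<open>m\<close>.\<close>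
    define m' where "m' = m - Poly_Mapping.single v 1"
    have m: "m = m' + Poly_Mapping.single v 1"
      using v unfolding m'_def
      by (intro poly_mapping_eqI)
         (auto simp: lookup_add lookup_minus lookup_single when_def in_keys_iff)
    have "Poly_Mapping.keys m' \<subseteq> V"
      using less.prems by (auto simp: m'_def in_keys_iff lookup_minus)
    moreover have "monom_degree m' < monom_degree m"
      by (simp add: m monom_degree_add monom_degree_single)
    ultimately show ?thesis
      using add[of m' v] less.hyps[of m'] less.prems v m by auto
  qed (use \<open>P 0\<close> in simp)
qed

lemma graded_part_mult:
  fixes p q :: "('v, 'a::comm_ring_1) mpoly"
  assumes "p \<in> graded_part (poly_ring V) d" "q \<in> graded_part (poly_ring V) e"
  shows "p * q \<in> graded_part (poly_ring V) (d + e)"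
proof -
  interpret cring "poly_ring V :: ('v, 'a) mpoly ring"
    by (rule cring_poly_ring)
  have "p * q \<in> carrier (poly_ring V)"
    using m_closed[of p q] assms by (simp add: graded_part_def del: poly_ring_simps(1))
  moreover have "monom_degree m = d + e" if m: "m \<in> Poly_Mapping.keys (p * q)" for m
  proof -
    obtain a b where "m = a + b" "a \<in> Poly_Mapping.keys p" "b \<in> Poly_Mapping.keys q"
      using m keys_mult[of p q] by blast
    then show ?thesis
      using assms by (simp add: monom_degree_add graded_part_def)
  qed
  ultimately show ?thesis
    by (simp add: graded_part_def del: poly_ring_simps(1))
qed

lemma graded_part_add:
  fixes p q :: "('v, 'a::comm_ring_1) mpoly"
  assumes "p \<in> graded_part (poly_ring V) d" "q \<in> graded_part (poly_ring V) d"
  shows "p + q \<in> graded_part (poly_ring V) d"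
  using assms keys_add[of p q] by (auto simp: graded_part_def; blast)

lemma graded_part_diff:
  fixes p q :: "('v, 'a::comm_ring_1) mpoly"
  assumes "p \<in> graded_part (poly_ring V) d" "q \<in> graded_part (poly_ring V) d"
  shows "p - q \<in> graded_part (poly_ring V) d"
proof -
  have "- q \<in> graded_part (poly_ring V) d"
    using assms(2) by (auto simp: graded_part_def in_keys_iff)
  from graded_part_add[OF assms(1) this] show ?thesis by simp
qed

lemma Var_in_graded_part:
  "v \<in> V \<Longrightarrow> Var v \<in> graded_part (poly_ring V :: ('v, 'a::comm_ring_1) mpoly ring) 1"
  by (auto simp: graded_part_def Var_def monom_degree_single)

section \<open>Real and imaginary part of the product over T\<close>

abbreviation lss_vars :: "nat \<Rightarrow> lss_var set" where
  "lss_vars n \<equiv> X ` {1..n} \<union> Y ` {1..n}"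

text \<open>\<open>f\<close> and \<open>g\<close> are the real and the imaginary part of the product
  of the \<open>z\<^sub>t\<close>. Quantifying over \<open>h\<close> and \<open>s\<close> lets the
  same pair serve for the complexification, its conjugate and both substitutions.\<close>

lemma real_parts_of_product:
  assumes "finite T" "T \<subseteq> {1..n}"
  obtains f g where "f \<in> graded_part (poly_ring (lss_vars n)) (card T)"
    "\<And>(h :: lss_var \<Rightarrow> (lss_var, complex) mpoly) s. s * s = - 1 \<Longrightarrow>
      eval_mpoly h f + Const s * eval_mpoly h g = (\<Prod>t\<in>T. h (X t) + Const s * h (Y t))"
proof -
  let ?G = "graded_part (poly_ring (lss_vars n) :: (lss_var, real) mpoly ring)"
  have "\<exists>f g. f \<in> ?G (card T) \<and> g \<in> ?G (card T) \<and>
    (\<forall>(h :: lss_var \<Rightarrow> (lss_var, complex) mpoly) s. s * s = - 1 \<longrightarrow>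
      eval_mpoly h f + Const s * eval_mpoly h g = (\<Prod>t\<in>T. h (X t) + Const s * h (Y t)))"
    using assms
  proof (induction T)
    case empty
    show ?case
      \<comment> \<open>The empty product is \<open>1 + s * 0\<close>; the zero polynomial is
        homogeneous of every degree.\<close>
      by (rule exI[of _ 1], rule exI[of _ 0]) (simp add: graded_part_def monom_degree_def)
  next
    case (insert t T)
    then obtain f g where fg: "f \<in> ?G (card T)" "g \<in> ?G (card T)"
      "\<And>(h :: lss_var \<Rightarrow> (lss_var, complex) mpoly) s. s * s = - 1 \<Longrightarrow>
        eval_mpoly h f + Const s * eval_mpoly h g = (\<Prod>t\<in>T. h (X t) + Const s * h (Y t))"
      by auto
    have t: "xv t \<in> ?G 1" "yv t \<in> ?G 1"
      using insert.prems by (intro Var_in_graded_part; auto)+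
    \<comment> \<open>Real and imaginary part of
      \<open>(x\<^sub>t + i y\<^sub>t) (f + i g)\<close>.\<close>
    define f' where "f' = xv t * f - yv t * g"
    define g' where "g' = xv t * g + yv t * f"
    have "f' \<in> ?G (card (insert t T))" "g' \<in> ?G (card (insert t T))"
      unfolding f'_def g'_def
      using insert.hyps graded_part_mult[OF t(1) fg(1)] graded_part_mult[OF t(1) fg(2)]
        graded_part_mult[OF t(2) fg(1)] graded_part_mult[OF t(2) fg(2)]
      by (auto intro!: graded_part_diff graded_part_add)
    moreover have "eval_mpoly h f' + Const s * eval_mpoly h g' =
        (\<Prod>t\<in>insert t T. h (X t) + Const s * h (Y t))"
      if "s * s = - 1" for h :: "lss_var \<Rightarrow> (lss_var, complex) mpoly" and s
    proof -
      let ?S = "Const s :: (lss_var, complex) mpoly"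
      have "(\<Prod>t\<in>insert t T. h (X t) + ?S * h (Y t)) =
          (h (X t) + ?S * h (Y t)) * (eval_mpoly h f + ?S * eval_mpoly h g)"
        using insert.hyps fg(3)[OF that] by simp
      also have "\<dots> = eval_mpoly h f' + ?S * eval_mpoly h g'
          + (?S * ?S + 1) * (h (Y t) * eval_mpoly h g)"
        by (simp add: f'_def g'_def algebra_simps)
      finally show ?thesis
        by (simp add: Const_square_minus_1[OF that])
    qed
    ultimately show ?case by blast
  qed
  then show ?thesis using that by blast
qed

section \<open>Products of isotropic coordinates modulo the ideal\<close>

lemma zc_in_cspan: "j \<in> {1..n} \<Longrightarrow> zc s j \<in> cspan (carrier (poly_ring (lss_vars n)))"
  unfolding zc_def
  by (metis (no_types) cspan_add cspan_mult complexify_in_cspan Const_in_cspan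
      ideal_carrier_poly_ring Var_in_carrier eval_mpoly_Var UnI1 UnI2 imageI)

lemma zc_mult:
  assumes "s * s = - 1"
  shows "zc s i * zc (- s) j =
    complexify (xv i * xv j + yv i * yv j) - Const s * complexify (xv i * yv j - xv j * yv i)"
proof -
  let ?S = "Const s :: (lss_var, complex) mpoly"
  have "zc s i * zc (- s) j =
      complexify (xv i * xv j + yv i * yv j) - ?S * complexify (xv i * yv j - xv j * yv i)
      - (?S * ?S + 1) * (Var (Y i) * Var (Y j))"
    by (simp add: zc_def single_uminus algebra_simps)
  then show ?thesis
    by (simp add: Const_square_minus_1[OF assms])
qed

text \<open>By \<open>zc_mult\<close> both summands have the same symmetric part, while their parts
  with factor \<open>s\<close> are antisymmetric in \<open>i\<close> and \<open>j\<close> and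
  cancel.\<close>

lemma zc_cross:
  assumes "s * s = - 1"
  shows "zc (- s) i * zc s j + zc (- s) j * zc s i =
    complexify (xv i * xv j + yv i * yv j) + complexify (xv i * xv j + yv i * yv j)"
proof -
  let ?S = "Const s :: (lss_var, complex) mpoly"
  have "zc (- s) i * zc s j + zc (- s) j * zc s i =
      complexify (xv i * xv j + yv i * yv j) + complexify (xv i * xv j + yv i * yv j)
      - (?S * ?S + 1) * (Var (Y i) * Var (Y j) + Var (Y i) * Var (Y j))"
    by (simp add: zc_def single_uminus algebra_simps)
  then show ?thesis
    by (simp add: Const_square_minus_1[OF assms])
qed

text \<open>This is the claim that \<open>w\<^sub>k F\<close> lies in the extended ideal. A vertex
  of \<open>T\<close> is handled by the alternating labelling alone; a vertex outside is first
  exchanged with a neighbour in \<open>T\<close>.\<close>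

lemma zc_prod_in_cspan:
  assumes J: "ideal J (poly_ring (lss_vars n))" and s: "s * s = - 1"
    and H: "wf_digraph H" "Digraph_Component.connected H" "\<not> bipartite H"
    and T: "verts H = T" "T \<subseteq> {1..n}"
    and arcs: "\<And>u v. (u, v) \<in> arcs_ends H \<Longrightarrow> u \<noteq> v \<and> xv u * xv v + yv u * yv v \<in> J"
    and k: "k \<in> {1..n}"
    and dom: "k \<notin> T \<Longrightarrow> \<exists>u\<in>T. xv k * xv u + yv k * yv u \<in> J"
  shows "zc (- s) k * (\<Prod>t\<in>T. zc s t) \<in> cspan J"
proof -
  define N where "N j = zc (- s) j * (\<Prod>t\<in>T - {j}. zc s t)" for j
  have fin: "finite T"
    using T(2) finite_subset by blast
  have cross: "zc (- s) i * zc s j + zc (- s) j * zc s i \<in> cspan J"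
    if "xv i * xv j + yv i * yv j \<in> J" for i j
    unfolding zc_cross[OF s] using cspan_add[OF J] complexify_in_cspan[OF J that] by blast
  have prod_in: "(\<Prod>t\<in>A. zc s t) \<in> cspan (carrier (poly_ring (lss_vars n)))" if "A \<subseteq> T" for A
    using that T(2) by (intro cspan_prod zc_in_cspan) auto
  have N: "N j \<in> cspan J" if "j \<in> T" for j
  proof (rule nonbipartite_alternating[OF H])
    show "0 \<in> cspan J"
      using complexify_in_cspan[OF J ideal_poly_ring(1)[OF J]] by simp
    show "j \<in> verts H"
      using that T by simp
    fix u v assume uv: "(u, v) \<in> arcs_ends H"
    interpret wf_digraph H by fact
    have "u \<in> T" "v \<in> T" "u \<noteq> v"
      using uv arcs adj_in_verts T by blast+
    then have "(\<Prod>t\<in>T - {u}. zc s t) = zc s v * (\<Prod>t\<in>T - {u} - {v}. zc s t)"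
      "(\<Prod>t\<in>T - {v}. zc s t) = zc s u * (\<Prod>t\<in>T - {v} - {u}. zc s t)"
      using fin by (simp_all add: prod.remove)
    moreover have "T - {u} - {v} = T - {u, v}" "T - {v} - {u} = T - {u, v}"
      by auto
    \<comment> \<open>The factors other than those at \<open>u\<close> and \<open>v\<close> are
      common to both terms; what remains is twice the generator of the edge.\<close>
    ultimately have "N u + N v =
        (\<Prod>t\<in>T - {u, v}. zc s t) * (zc (- s) u * zc s v + zc (- s) v * zc s u)"
      by (simp add: N_def algebra_simps)
    then show "N u + N v \<in> cspan J"
      using cspan_mult[OF J prod_in cross] arcs[OF uv] by simp
  qed (use cspan_diff[OF J] cspan_halve[OF J] in blast)+
  have F: "(\<Prod>t\<in>T. zc s t) = zc s j * (\<Prod>t\<in>T - {j}. zc s t)" if "j \<in> T" for j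
    using fin that by (simp add: prod.remove)
  show ?thesis
  proof (cases "k \<in> T")
    case True
    then have "zc (- s) k * (\<Prod>t\<in>T. zc s t) = zc s k * N k"
      by (simp add: F[of k] N_def mult_ac)
    then show ?thesis
      using cspan_mult[OF J zc_in_cspan[OF k] N[OF True]] by simp
  next
    case False
    then obtain u where u: "u \<in> T" "xv k * xv u + yv k * yv u \<in> J"
      using dom by blast
    \<comment> \<open>Adding and subtracting \<open>zc (- s) u * zc s k\<close> moves the
      conjugation from \<open>k\<close> to its neighbour \<open>u\<close>, where it produces
      \<open>N u\<close>.\<close>
    have "zc (- s) k * (\<Prod>t\<in>T. zc s t) =
        (\<Prod>t\<in>T - {u}. zc s t) * (zc (- s) k * zc s u + zc (- s) u * zc s k) - zc s k * N u"
      by (simp add: F[OF u(1)] N_def algebra_simps)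
    then show ?thesis
      using cspan_diff[OF J cspan_mult[OF J prod_in cross[OF u(2)]]
          cspan_mult[OF J zc_in_cspan[OF k] N[OF u(1)]]] by simp
  qed
qed

section \<open>Kernels of the two substitutions\<close>

text \<open>For \<open>s = i\<close> this is the substitution \<open>w = 0\<close>: it fixes \<open>z\<^sub>j\<close> and sends \<open>w\<^sub>j\<close> to \<open>0\<close>.\<close>

definition branch_map :: "complex \<Rightarrow> (lss_var, real) mpoly \<Rightarrow> (lss_var, complex) mpoly" where
  "branch_map s = eval_mpoly (\<lambda>v. case v of
     X j \<Rightarrow> Const (1 / 2) * zc s j | Y j \<Rightarrow> Const (- s / 2) * zc s j)"

lemma branch_map_simps [simp]:
  "branch_map s (Var (X j)) = Const (1 / 2) * zc s j"
  "branch_map s (Var (Y j)) = Const (- s / 2) * zc s j"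
  "branch_map s 0 = 0"
  "branch_map s (p + q) = branch_map s p + branch_map s q"
  "branch_map s (p - q) = branch_map s p - branch_map s q"
  "branch_map s (p * q) = branch_map s p * branch_map s q"
  by (simp_all add: branch_map_def)

text \<open>At each index \<open>x\<close> and \<open>y\<close> become multiples of the same form,
  with coefficients \<open>1 / 2\<close> and \<open>- s / 2\<close>. The squares of these sum to
  zero, and proportionality kills the minors.\<close>

lemma branch_map_generators:
  assumes "s * s = - 1"
  shows "branch_map s (xv i * xv j + yv i * yv j) = 0"
    and "branch_map s (xv i * yv j - xv j * yv i) = 0"
proof -
  have "branch_map s (xv i * xv j + yv i * yv j) =
      (Const (1 / 2 * (1 / 2)) + Const (- s / 2 * (- s / 2))) * (zc s i * zc s j)"
    by (simp only: branch_map_simps Const_mult) (simp add: algebra_simps)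
  also have "(Const (1 / 2 * (1 / 2)) + Const (- s / 2 * (- s / 2))) = (0 :: (lss_var, complex) mpoly)"
    by (simp add: assms flip: single_add)
  finally show "branch_map s (xv i * xv j + yv i * yv j) = 0" by simp
  show "branch_map s (xv i * yv j - xv j * yv i) = 0"
    by (simp add: algebra_simps)
qed

text \<open>Negatives need no separate check, being multiples by \<open>- 1\<close>.\<close>

lemma ideal_poly_ringI:
  fixes J :: "('v, 'a::comm_ring_1) mpoly set"
  assumes J: "J \<subseteq> carrier (poly_ring V)" "0 \<in> J"
    and add: "\<And>p q. p \<in> J \<Longrightarrow> q \<in> J \<Longrightarrow> p + q \<in> J"
    and mult: "\<And>c p. c \<in> carrier (poly_ring V) \<Longrightarrow> p \<in> J \<Longrightarrow> c * p \<in> J"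
  shows "ideal J (poly_ring V)"
proof -
  interpret R: cring "poly_ring V :: ('v, 'a) mpoly ring"
    by (rule cring_poly_ring)
  have minus: "\<ominus>\<^bsub>poly_ring V\<^esub> p = - 1 * p" "- 1 * p \<in> J" if p: "p \<in> J" for p
  proof -
    have "- 1 \<in> carrier (poly_ring V :: ('v, 'a) mpoly ring)"
      by (auto simp: in_keys_iff lookup_one when_def)
    from mult[OF this p] show "- 1 * p \<in> J" .
    then show "\<ominus>\<^bsub>poly_ring V\<^esub> p = - 1 * p"
      using J p by (intro R.minus_equality) (auto simp del: poly_ring_simps(1))
  qed
  show ?thesis
  proof (rule idealI)
    show "subgroup J (add_monoid (poly_ring V))"
    proof (rule R.add.subgroupI)
      show "\<ominus>\<^bsub>poly_ring V\<^esub> p \<in> J" if "p \<in> J" for p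
        using minus[OF that] by simp
    qed (use J add in auto)
    show "c \<otimes>\<^bsub>poly_ring V\<^esub> p \<in> J" "p \<otimes>\<^bsub>poly_ring V\<^esub> c \<in> J"
      if "p \<in> J" "c \<in> carrier (poly_ring V)" for p c
      using mult[OF that(2,1)] by (simp_all add: mult.commute)
  qed (rule R.ring_axioms)
qed

lemma carrier_poly_ring_closed:
  fixes p q :: "('v, 'a::comm_ring_1) mpoly"
  assumes "p \<in> carrier (poly_ring V)" "q \<in> carrier (poly_ring V)"
  shows "p + q \<in> carrier (poly_ring V)" "p - q \<in> carrier (poly_ring V)"
    "p * q \<in> carrier (poly_ring V)"
  using ideal_poly_ring(2,4,5)[OF ideal_carrier_poly_ring, of p V q] assms by blast+

lemma Idl_poly_ring:
  fixes S :: "('v, 'a::comm_ring_1) mpoly set"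
  assumes "S \<subseteq> carrier (poly_ring V)"
  shows "ideal (Idl\<^bsub>poly_ring V\<^esub> S) (poly_ring V)" "S \<subseteq> Idl\<^bsub>poly_ring V\<^esub> S"
    "\<And>J. ideal J (poly_ring V) \<Longrightarrow> S \<subseteq> J \<Longrightarrow> Idl\<^bsub>poly_ring V\<^esub> S \<subseteq> J"
proof -
  interpret R: cring "poly_ring V :: ('v, 'a) mpoly ring"
    by (rule cring_poly_ring)
  show "ideal (Idl\<^bsub>poly_ring V\<^esub> S) (poly_ring V)" "S \<subseteq> Idl\<^bsub>poly_ring V\<^esub> S"
    using R.genideal_ideal R.genideal_self assms by blast+
  show "Idl\<^bsub>poly_ring V\<^esub> S \<subseteq> J" if "ideal J (poly_ring V)" "S \<subseteq> J" for J
    using R.genideal_minimal that by blast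
qed

lemma branch_map_vanishes:
  assumes "S \<subseteq> carrier (poly_ring V)" "\<And>p. p \<in> S \<Longrightarrow> branch_map s p = 0"
    and "p \<in> Idl\<^bsub>poly_ring V\<^esub> S"
  shows "branch_map s p = 0"
proof -
  have "ideal {p \<in> carrier (poly_ring V). branch_map s p = 0} (poly_ring V)"
    by (rule ideal_poly_ringI) (auto simp: carrier_poly_ring_closed simp del: poly_ring_simps(1)
      intro: ideal_poly_ring(1)[OF ideal_carrier_poly_ring])
  from Idl_poly_ring(3)[OF assms(1) this] show ?thesis
    using assms by blast
qed

section \<open>The ideal of the complete graph\<close>

text \<open>Treats both kinds of variables uniformly. The index \<open>i\<close> does not depend on
  \<open>s\<close>; only the scalar does.\<close>

lemma branch_map_Var:
  obtains c i where "\<And>s. branch_map s (Var v) = Const (c s) * zc s i"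
    "v \<in> lss_vars n \<Longrightarrow> i \<in> {1..n}"
proof (cases v)
  case (X i)
  show ?thesis
    by (rule that[of "\<lambda>s. 1 / 2" i]) (use X in auto)
next
  case (Y i)
  show ?thesis
    by (rule that[of "\<lambda>s. - s / 2" i]) (use Y in auto)
qed

text \<open>These are the inversion formulas \<open>x = (z + w) / 2\<close> and
  \<open>y = (z - w) / (2 s)\<close>, with \<open>z = zc s i\<close> and
  \<open>w = zc (- s) i\<close>.\<close>

lemma Var_eq_branch_sum:
  assumes "s * s = - 1"
  shows "Var v = branch_map s (Var v) + branch_map (- s) (Var v)"
proof (cases v)
  case (X i)
  have "branch_map s (Var v) + branch_map (- s) (Var v) =
      (Const (1 / 2) + Const (1 / 2)) * Var (X i)
      + Const (1 / 2) * (Const s + Const (- s)) * Var (Y i)"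
    unfolding X by (simp only: branch_map_simps zc_def ring_distribs mult.assoc) simp
  then show ?thesis
    by (simp add: X flip: single_add)
next
  case (Y i)
  have "branch_map s (Var v) + branch_map (- s) (Var v) =
      (Const (- s / 2) + Const (s / 2)) * Var (X i)
      + (Const (- s / 2 * s) + Const (s / 2 * - s)) * Var (Y i)"
    unfolding Y
    by (simp only: branch_map_simps zc_def ring_distribs Const_mult minus_minus mult.assoc) simp
  also have "Const (- s / 2 * s) + Const (s / 2 * - s) = (1 :: (lss_var, complex) mpoly)"
    by (simp add: assms flip: single_add)
  finally show ?thesis
    by (simp add: Y flip: single_add)
qed

abbreviation I_K_gens :: "nat \<Rightarrow> (lss_var, real) mpoly set" where
  "I_K_gens n \<equiv>
    {xv i * xv j + yv i * yv j | i j. 1 \<le> i \<and> i < j \<and> j \<le> n} \<union>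
     {xv i * yv j - xv j * yv i | i j. 1 \<le> i \<and> i < j \<and> j \<le> n} \<union>
     {(xv i)\<^sup>2 + (yv i)\<^sup>2 | i. 1 \<le> i \<and> i \<le> n}"

lemma I_K_subset_carrier:
  "I_K_gens n \<subseteq> carrier (poly_ring (lss_vars n))"
  by (auto simp: power2_eq_square simp del: poly_ring_simps(1)
      intro!: carrier_poly_ring_closed Var_in_carrier)

text \<open>The sums of squares are the diagonal case of the first family, so two shapes of
  generators suffice.\<close>

lemma I_K_gensE:
  assumes "q \<in> I_K_gens n"
  obtains i j where "i \<in> {1..n}" "j \<in> {1..n}"
    "q = xv i * xv j + yv i * yv j \<or> q = xv i * yv j - xv j * yv i"
  using assms
proof (elim UnE CollectE exE conjE)
  fix i assume "q = (xv i)\<^sup>2 + (yv i)\<^sup>2" "1 \<le> i" "i \<le> n"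
  then show thesis
    by (intro that[of i i]) (simp_all add: power2_eq_square)
next
  fix i j assume "q = xv i * xv j + yv i * yv j" "1 \<le> i" "i < j" "j \<le> n"
  then show thesis
    by (intro that[of i j]) simp_all
next
  fix i j assume "q = xv i * yv j - xv j * yv i" "1 \<le> i" "i < j" "j \<le> n"
  then show thesis
    by (intro that[of i j]) simp_all
qed

lemma ideal_I_K: "ideal (I_K n) (poly_ring (lss_vars n))"
  unfolding I_K_def lss_ring_def by (rule Idl_poly_ring(1)[OF I_K_subset_carrier])

text \<open>The restriction \<open>i < j\<close> can be lifted: the first form is symmetric and on
  the diagonal a sum of squares; the second is antisymmetric and vanishes there.\<close>

lemma I_K_mem:
  assumes "i \<in> {1..n}" "j \<in> {1..n}"
  shows "xv i * xv j + yv i * yv j \<in> I_K n" "xv i * yv j - xv j * yv i \<in> I_K n"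
proof -
  have gens_subset: "I_K_gens n \<subseteq> I_K n"
    unfolding I_K_def lss_ring_def by (rule Idl_poly_ring(2)[OF I_K_subset_carrier])
  have gens: "xv i * xv j + yv i * yv j \<in> I_K n" "xv i * yv j - xv j * yv i \<in> I_K n"
    if "1 \<le> i" "i < j" "j \<le> n" for i j
    by (rule subsetD[OF gens_subset], use that in blast)+
  have "(xv i)\<^sup>2 + (yv i)\<^sup>2 \<in> I_K n"
    by (rule subsetD[OF gens_subset]) (use assms in auto)
  then have sq: "xv i * xv i + yv i * yv i \<in> I_K n"
    by (simp only: power2_eq_square)
  consider "i < j" | "i = j" | "j < i" by linarith
  then have "xv i * xv j + yv i * yv j \<in> I_K n \<and> xv i * yv j - xv j * yv i \<in> I_K n"
  proof cases
    case 1
    then show ?thesis using gens[of i j] assms by auto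
  next
    case 2
    then show ?thesis using sq ideal_poly_ring(1)[OF ideal_I_K] by simp
  next
    case 3
    then show ?thesis
      using gens[of j i] assms ideal_poly_ring(3)[OF ideal_I_K, of "xv j * yv i - xv i * yv j" n]
      by (auto simp: mult.commute)
  qed
  then show "xv i * xv j + yv i * yv j \<in> I_K n" "xv i * yv j - xv j * yv i \<in> I_K n"
    by auto
qed

lemma branch_map_I_K:
  assumes "s * s = - 1" "p \<in> I_K n"
  shows "branch_map s p = 0"
proof -
  have "branch_map s q = 0" if q: "q \<in> I_K_gens n" for q
  proof -
    obtain i j where "q = xv i * xv j + yv i * yv j \<or> q = xv i * yv j - xv j * yv i"
      using q by (rule I_K_gensE)
    then show ?thesis
      by (elim disjE) (simp_all only: branch_map_generators[OF assms(1)])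
  qed
  from branch_map_vanishes[OF I_K_subset_carrier this] assms(2) show ?thesis
    unfolding I_K_def lss_ring_def by simp
qed

lemma zc_mult_in_cspan_I_K:
  assumes "s * s = - 1" "i \<in> {1..n}" "j \<in> {1..n}"
  shows "zc s i * zc (- s) j \<in> cspan (I_K n)"
  unfolding zc_mult[OF assms(1)]
  by (intro cspan_diff[OF ideal_I_K] cspan_mult[OF ideal_I_K Const_in_cspan]
      complexify_in_cspan[OF ideal_I_K] I_K_mem assms)

abbreviation monomial :: "('v \<Rightarrow>\<^sub>0 nat) \<Rightarrow> ('v, real) mpoly" where
  "monomial m \<equiv> Poly_Mapping.single m 1"

lemma monomial_add_Var:
  "monomial (m + Poly_Mapping.single v 1) = monomial m * Var v"
  by (simp add: Var_def mult_single)

lemma branch_map_monomial_0: "branch_map s (monomial 0) = 1"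
  by (simp add: branch_map_def)

lemma branch_map_Var_in_cspan:
  assumes "v \<in> lss_vars n"
  shows "branch_map s (Var v) \<in> cspan (carrier (poly_ring (lss_vars n)))"
proof -
  obtain c i where "\<And>s. branch_map s (Var v) = Const (c s) * zc s i" "i \<in> {1..n}"
    using branch_map_Var[of v n] assms by metis
  then show ?thesis
    using cspan_mult[OF ideal_carrier_poly_ring Const_in_cspan zc_in_cspan] by simp
qed

lemma branch_map_monomial_in_cspan:
  assumes "Poly_Mapping.keys m \<subseteq> lss_vars n"
  shows "branch_map s (monomial m) \<in> cspan (carrier (poly_ring (lss_vars n)))"
  using assms
proof (induction rule: monom_induct)
  case zero
  then show ?case
    using Const_in_cspan[of 1 "lss_vars n"] unfolding branch_map_monomial_0 by simp
next
  case (add m v)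
  then show ?case
    unfolding monomial_add_Var branch_map_simps
    by (intro cspan_mult[OF ideal_carrier_poly_ring] branch_map_Var_in_cspan)
qed

text \<open>Since \<open>m\<close> is not constant, the product contains some
  \<open>zc s i * zc (- s) j\<close>, which lies in the span of \<open>I_K\<close>.\<close>

lemma branch_map_mixed_in_cspan:
  assumes s: "s * s = - 1" and v: "v \<in> lss_vars n"
    and "Poly_Mapping.keys m \<subseteq> lss_vars n" "m \<noteq> 0"
  shows "branch_map s (monomial m) * branch_map (- s) (Var v) \<in> cspan (I_K n)"
proof -
  \<comment> \<open>The first alternative absorbs the base case; in the step the new variable
    \<open>u\<close> supplies the factor \<open>zc s i\<close>.\<close>
  have "m = 0 \<or> branch_map s (monomial m) * branch_map (- s) (Var v) \<in> cspan (I_K n)"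
    using assms(3)
  proof (induction rule: monom_induct)
    case (add m u)
    obtain c i where u: "\<And>s. branch_map s (Var u) = Const (c s) * zc s i" "i \<in> {1..n}"
      using branch_map_Var[of u n] add.hyps by metis
    obtain d j where v': "\<And>s. branch_map s (Var v) = Const (d s) * zc s j" "j \<in> {1..n}"
      using branch_map_Var[of v n] v by metis
    have "branch_map s (monomial (m + Poly_Mapping.single u 1)) * branch_map (- s) (Var v) =
        branch_map s (monomial m) * (Const (c s) * (Const (d (- s)) * (zc s i * zc (- s) j)))"
      unfolding monomial_add_Var branch_map_simps u(1) v'(1) by (simp only: mult_ac)
    also have "\<dots> \<in> cspan (I_K n)"
      by (intro cspan_mult[OF ideal_I_K] Const_in_cspan branch_map_monomial_in_cspan add
          zc_mult_in_cspan_I_K s u v')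
    finally show ?case ..
  qed simp
  with assms(4) show ?thesis by blast
qed

text \<open>
  Modulo \<open>I_K\<close> only pure monomials in \<open>z\<close> or in \<open>w\<close> survive, and the two substitutions pick
  them out; the constant monomial is counted twice.
\<close>

lemma monomial_eq_branch_sum:
  assumes s: "s * s = - 1" and "Poly_Mapping.keys m \<subseteq> lss_vars n"
  shows "complexify (monomial m) + (if m = 0 then 1 else 0)
    - (branch_map s (monomial m) + branch_map (- s) (monomial m)) \<in> cspan (I_K n)"
  using assms(2)
proof (induction rule: monom_induct)
  case zero
  have "complexify (monomial 0) = (1 :: (lss_var, complex) mpoly)"
    by simp
  then show ?case
    using complexify_in_cspan[OF ideal_I_K ideal_poly_ring(1)[OF ideal_I_K]]
    by (simp only: branch_map_monomial_0) simp
next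
  case (add m v)
  let ?p = "branch_map s (monomial m)" and ?q = "branch_map (- s) (monomial m)"
  have ne: "m + Poly_Mapping.single v 1 \<noteq> 0"
  proof
    assume "m + Poly_Mapping.single v 1 = 0"
    then have "Poly_Mapping.lookup (m + Poly_Mapping.single v 1) v = 0" by simp
    then show False by (simp add: lookup_add)
  qed
  show ?case
  proof (cases "m = 0")
    \<comment> \<open>A single variable splits exactly into its two branches, so the difference is
      zero.\<close>
    case True
    have "complexify (Var v) - (branch_map s (Var v) + branch_map (- s) (Var v)) = 0"
      using Var_eq_branch_sum[OF s, of v] by simp
    moreover have "m + Poly_Mapping.single v 1 = Poly_Mapping.single v 1"
      "monomial (Poly_Mapping.single v 1) = Var v"
      by (simp_all add: True Var_def)
    moreover have "0 \<in> cspan (I_K n)"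
      using complexify_in_cspan[OF ideal_I_K ideal_poly_ring(1)[OF ideal_I_K]] by simp
    ultimately show ?thesis
      using ne by (simp only: if_False add_0_right)
  next
    case False
    \<comment> \<open>Multiply the relation for \<open>m\<close> by \<open>v\<close>, split into its
      two branches: the pure products form the new relation and the two mixed products are left
      over.\<close>
    have "complexify (monomial (m + Poly_Mapping.single v 1)) + 0
        - (branch_map s (monomial (m + Poly_Mapping.single v 1))
          + branch_map (- s) (monomial (m + Poly_Mapping.single v 1)))
      = complexify (Var v) * (complexify (monomial m) + 0 - (?p + ?q))
        + (?p * branch_map (- s) (Var v) + ?q * branch_map (- (- s)) (Var v))"
      unfolding monomial_add_Var branch_map_simps eval_mpoly_mult eval_mpoly_Var
      by (subst (1 2) Var_eq_branch_sum[OF s]) (simp add: algebra_simps)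
    also have "\<dots> \<in> cspan (I_K n)"
      using add.IH False
      by (intro cspan_add[OF ideal_I_K] cspan_mult[OF ideal_I_K] branch_map_mixed_in_cspan
          complexify_in_cspan[OF ideal_carrier_poly_ring] Var_in_carrier add)
         (simp_all add: s)
    finally show ?thesis
      using ne by (simp only: if_False)
  qed
qed

text \<open>Summing the monomial relations over the terms of \<open>p\<close> puts \<open>p\<close>
  plus its constant term into \<open>I_K\<close>; that constant term is then shown to be
  zero.\<close>

lemma I_K_memI:
  assumes s: "s * s = - 1" and p: "p \<in> carrier (poly_ring (lss_vars n))"
    and zero: "branch_map s p = 0" "branch_map (- s) p = 0"
  shows "p \<in> I_K n"
proof -
  let ?l = "Poly_Mapping.lookup p"
  let ?D = "\<lambda>m. complexify (monomial m) + (if m = 0 then 1 else 0)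
    - (branch_map s (monomial m) + branch_map (- s) (monomial m))"
  have expand: "eval_mpoly h p =
      (\<Sum>m\<in>Poly_Mapping.keys p. Const (of_real (?l m)) * eval_mpoly h (monomial m))"
    for h :: "lss_var \<Rightarrow> (lss_var, complex) mpoly"
    by (simp add: eval_mpoly_def[of h p] eval_mpoly_single)
  have "(\<Sum>m\<in>Poly_Mapping.keys p. Const (complex_of_real (?l m)) * (if m = 0 then 1 else 0)) =
      (Const (of_real (?l 0)) :: (lss_var, complex) mpoly)"
    by (simp add: if_distrib[of "(*) _"] sum.delta in_keys_iff cong: if_cong)
  then have "complexify p + Const (of_real (?l 0)) - (branch_map s p + branch_map (- s) p) =
      (\<Sum>m\<in>Poly_Mapping.keys p. Const (of_real (?l m)) * ?D m)"
    unfolding branch_map_def expand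
    by (simp only: ring_distribs sum.distrib sum_subtractf right_diff_distrib)
  also have "\<dots> \<in> cspan (I_K n)"
    using p by (intro cspan_sum[OF ideal_I_K] cspan_mult[OF ideal_I_K Const_in_cspan]
        monomial_eq_branch_sum s) auto
  finally have "complexify (p + Const (?l 0)) \<in> cspan (I_K n)"
    by (simp add: zero eval_mpoly_Const)
  then have mem: "p + Const (?l 0) \<in> I_K n"
    by (rule complexify_in_cspanD)
  \<comment> \<open>The substitution kills both \<open>p\<close> and the element of
    \<open>I_K\<close>, hence also their difference, but it fixes constants.\<close>
  have "branch_map s (Const (?l 0)) = 0"
    using branch_map_I_K[OF s mem] zero by simp
  then have "?l 0 = 0"
    by (simp add: branch_map_def eval_mpoly_Const)
       (metis lookup_single_eq lookup_zero of_real_eq_0_iff)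
  with mem show ?thesis by simp
qed

lemma I_K_mult_subset:
  assumes L: "ideal L (poly_ring (lss_vars n))"
    and mult: "\<And>s i j. s * s = - 1 \<Longrightarrow> i \<in> {1..n} \<Longrightarrow> j \<in> {1..n} \<Longrightarrow>
      zc s i * zc (- s) j * complexify f \<in> cspan L"
    and p: "p \<in> I_K n"
  shows "p * f \<in> L"
proof -
  have P: "(xv i * xv j + yv i * yv j) * f \<in> L" and Q: "(xv i * yv j - xv j * yv i) * f \<in> L"
    if ij: "i \<in> {1..n}" "j \<in> {1..n}" for i j
  proof -
    let ?P = "complexify (xv i * xv j + yv i * yv j)"
      and ?Q = "complexify (xv i * yv j - xv j * yv i)"
    have s: "\<i> * \<i> = - 1" by simp
    have "(?P + ?P) * complexify f \<in> cspan L"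
      unfolding zc_cross[OF s, symmetric]
      using cspan_add[OF L mult[OF s ij(2,1)] mult[OF s ij]] by (simp add: algebra_simps)
    then have "?P * complexify f + ?P * complexify f \<in> cspan L"
      by (simp only: ring_distribs)
    then have P: "?P * complexify f \<in> cspan L"
      by (rule cspan_halve[OF L])
    then show "(xv i * xv j + yv i * yv j) * f \<in> L"
      by (intro complexify_in_cspanD) simp
    \<comment> \<open>By \<open>zc_mult\<close> the bracket is
      \<open>Const \<i> * ?Q * complexify f\<close>; a second factor \<open>Const \<i>\<close> makes
      the coefficient real.\<close>
    have "Const \<i> * (?P * complexify f - zc \<i> i * zc (- \<i>) j * complexify f)
        = Const \<i> * Const \<i> * (?Q * complexify f)"
    proof -
      have "c * (a * r - (a - c * b) * r) = c * c * (b * r)" for a b c r :: "(lss_var, complex) mpoly"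
        by (simp add: algebra_simps)
      then show ?thesis
        unfolding zc_mult[OF s] .
    qed
    also have "\<dots> = - complexify ((xv i * yv j - xv j * yv i) * f)"
      by (simp add: Const_i_square)
    finally have "- complexify ((xv i * yv j - xv j * yv i) * f) \<in> cspan L"
      using cspan_mult[OF L Const_in_cspan[of \<i>] cspan_diff[OF L P mult[OF s ij]]] by simp
    from cspan_minus[OF L this] have "complexify ((xv i * yv j - xv j * yv i) * f) \<in> cspan L"
      by (simp only: minus_minus)
    then show "(xv i * yv j - xv j * yv i) * f \<in> L"
      by (rule complexify_in_cspanD)
  qed
  \<comment> \<open>The multipliers taking \<open>f\<close> into \<open>L\<close> form an ideal, so
    generators suffice.\<close>
  let ?C = "{p \<in> carrier (poly_ring (lss_vars n)). p * f \<in> L}"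
  have "ideal ?C (poly_ring (lss_vars n))"
  proof (rule ideal_poly_ringI)
    show "0 \<in> ?C"
      using ideal_poly_ring(1)[OF L] by simp
    show "p + q \<in> ?C" if "p \<in> ?C" "q \<in> ?C" for p q
      using that ideal_poly_ring(2)[OF L]
      by (auto simp: carrier_poly_ring_closed ring_distribs simp del: poly_ring_simps(1))
    show "c * p \<in> ?C" if "c \<in> carrier (poly_ring (lss_vars n))" "p \<in> ?C" for c p
      using that ideal_poly_ring(5)[OF L]
      by (auto simp: carrier_poly_ring_closed mult.assoc simp del: poly_ring_simps(1))
  qed blast
  moreover have "I_K_gens n \<subseteq> ?C"
  proof
    fix q assume q: "q \<in> I_K_gens n"
    then obtain i j where ij: "i \<in> {1..n}" "j \<in> {1..n}"
      and "q = xv i * xv j + yv i * yv j \<or> q = xv i * yv j - xv j * yv i"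
      by (rule I_K_gensE)
    from this(3) have "q * f \<in> L"
      by (elim disjE) (simp_all only: P[OF ij] Q[OF ij])
    with subsetD[OF I_K_subset_carrier q] show "q \<in> ?C"
      by blast
  qed
  ultimately have "I_K n \<subseteq> ?C"
    unfolding I_K_def lss_ring_def by (rule Idl_poly_ring(3)[OF I_K_subset_carrier])
  with p show ?thesis by blast
qed

section \<open>The colon ideal and the bound\<close>

theorem theorem5p9:
  fixes n :: nat and G :: "nat pair_pre_digraph"
  assumes "pair_graph G" and "pverts G = {1..n}"
    and "Digraph_Component.connected (with_proj G)"
    and "\<not> bipartite (with_proj G)"
  shows "v_number (lss_ring n) (I_K n) (lss_ideal n G) \<le> enat (gamma_cn (with_proj G))"
proof -
  interpret pair_graph G by fact
  let ?R = "poly_ring (lss_vars n) :: (lss_var, real) mpoly ring"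
  \<comment> \<open>The minimum is attained, as the full vertex set is admissible.\<close>
  have "gamma_cn (with_proj G) \<in> card ` conn_nonbip_dominating_sets (with_proj G)"
    unfolding gamma_cn_def
    using finite_conn_nonbip_dominating_sets[of "with_proj G"]
      verts_in_conn_nonbip_dominating_sets[of "with_proj G"] assms wf_digraph_axioms
    by (intro Min_in) auto
  then obtain T where T: "card T = gamma_cn (with_proj G)" "dominating_set (with_proj G) T"
    "Digraph_Component.connected (with_proj G \<restriction> T)" "\<not> bipartite (with_proj G \<restriction> T)"
    by (auto simp: conn_nonbip_dominating_sets_def)
  let ?H = "with_proj G \<restriction> T"
  have Tn: "T \<subseteq> {1..n}"
    using T(2) assms(2) by (simp add: dominating_set_def)
  have fin: "finite T"
    using Tn finite_subset by blast
  \<comment> \<open>Connectedness includes having a vertex. Below, a product of zeros over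
    \<open>T\<close> must vanish.\<close>
  have "T \<noteq> {}"
    using T(3) by (auto simp: connected_def strongly_connected_def mk_symmetric_def)
  define S where "S = {xv i * xv j + yv i * yv j | i j. (i, j) \<in> parcs G}"
  define L where "L = Idl\<^bsub>?R\<^esub> S"
  have L_eq: "lss_ideal n G = L"
    by (simp add: lss_ideal_def lss_ring_def L_def S_def)
  have S: "S \<subseteq> carrier ?R"
    using in_arcsD1 in_arcsD2 assms(2)
    by (auto simp: S_def simp del: poly_ring_simps(1)
        intro!: carrier_poly_ring_closed Var_in_carrier)
  have L: "ideal L ?R" and SL: "S \<subseteq> L"
    unfolding L_def using Idl_poly_ring[OF S] by auto
  have edge: "xv i * xv j + yv i * yv j \<in> L" if "(i, j) \<in> parcs G" for i j
    using SL that by (auto simp: S_def)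
  have branch_L: "branch_map s p = 0" if "s * s = - 1" "p \<in> L" for s p
    using branch_map_vanishes[OF S] branch_map_generators(1)[OF that(1)] that(2)
    unfolding L_def S_def by blast
  obtain f g where fg: "f \<in> graded_part ?R (card T)"
    "\<And>(h :: lss_var \<Rightarrow> (lss_var, complex) mpoly) s. s * s = - 1 \<Longrightarrow>
      eval_mpoly h f + Const s * eval_mpoly h g = (\<Prod>t\<in>T. h (X t) + Const s * h (Y t))"
    using real_parts_of_product[OF fin Tn] by blast
  have killed: "zc (- s) k * (\<Prod>t\<in>T. zc s t) \<in> cspan L" if s: "s * s = - 1" and k: "k \<in> {1..n}" for s k
  proof (rule zc_prod_in_cspan[OF L s _ T(3,4) _ Tn _ k])
    show "wf_digraph ?H"
      by (rule wellformed_induce_subgraph)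
    show "u \<noteq> v \<and> xv u * xv v + yv u * yv v \<in> L" if "(u, v) \<in> arcs_ends ?H" for u v
    proof -
      have "(u, v) \<in> parcs G"
        using that by (auto simp: arcs_ends_def arc_to_ends_def)
      then show ?thesis
        using edge pair_no_loops[of "(u, v)"] by auto
    qed
    show "\<exists>u\<in>T. xv k * xv u + yv k * yv u \<in> L" if kT: "k \<notin> T"
    proof -
      have "k \<in> verts (with_proj G) - T"
        using k kT assms(2) by simp
      then obtain u where "u \<in> T" "(k, u) \<in> arcs_ends (with_proj G)"
        using T(2) unfolding dominating_set_def by blast
      then show ?thesis
        using edge by auto
    qed
  qed simp
  \<comment> \<open>The real part is half the sum of the product and its conjugate.\<close>
  have f_sum: "complexify f + complexify f = (\<Prod>t\<in>T. zc s t) + (\<Prod>t\<in>T. zc (- s) t)"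
    if "s * s = - 1" for s
    using fg(2)[OF that, of Var] fg(2)[of "- s" Var] that
    by (simp add: zc_def single_uminus algebra_simps)
  have sub: "p * f \<in> L" if "p \<in> I_K n" for p
  proof (rule I_K_mult_subset[OF L _ that])
    fix s :: complex and i j assume s: "s * s = - 1" and ij: "i \<in> {1..n}" "j \<in> {1..n}"
    have "zc s i * zc (- s) j * complexify f + zc s i * zc (- s) j * complexify f =
        zc s i * zc (- s) j * ((\<Prod>t\<in>T. zc s t) + (\<Prod>t\<in>T. zc (- s) t))"
      unfolding f_sum[OF s, symmetric] by (simp only: ring_distribs)
    \<comment> \<open>Each summand takes the factor that carries it into the ideal:
      \<open>zc (- s) j\<close> for the product, \<open>zc s i\<close> for its conjugate.\<close>
    also have "\<dots> = zc s i * (zc (- s) j * (\<Prod>t\<in>T. zc s t))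
        + zc (- s) j * (zc (- (- s)) i * (\<Prod>t\<in>T. zc (- s) t))"
      by (simp add: algebra_simps)
    also have "\<dots> \<in> cspan L"
      using s by (intro cspan_add[OF L] cspan_mult[OF L] zc_in_cspan killed ij) simp_all
    finally show "zc s i * zc (- s) j * complexify f \<in> cspan L"
      by (rule cspan_halve[OF L])
  qed
  \<comment> \<open>If \<open>f\<close> were killed, \<open>s\<close> times the image of
    \<open>g\<close> would be the nonzero product of the \<open>zc s t\<close>. Yet the identity for
    \<open>- s\<close> makes it zero, since there every factor vanishes.\<close>
  have f_nz: "branch_map s f \<noteq> 0" if s: "s * s = - 1" for s
  proof
    assume 0: "branch_map s f = 0"
    let ?h = "\<lambda>v. case v of X j \<Rightarrow> Const (1 / 2) * zc s j | Y j \<Rightarrow> Const (- s / 2) * zc s j"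
    have "branch_map s f + Const s * branch_map s g = (\<Prod>t\<in>T. ?h (X t) + Const s * ?h (Y t))"
      unfolding branch_map_def by (rule fg(2)[OF s])
    also have "\<dots> = (\<Prod>t\<in>T. zc s t)"
    proof (rule prod.cong[OF refl])
      fix t
      have "?h (X t) + Const s * ?h (Y t) = (Const (1 / 2) + Const (s * (- s / 2))) * zc s t"
        by (simp only: lss_var.case Const_mult ring_distribs mult.assoc)
      also have "Const (1 / 2) + Const (s * (- s / 2)) = (1 :: (lss_var, complex) mpoly)"
        by (simp add: s flip: single_add)
      finally show "?h (X t) + Const s * ?h (Y t) = zc s t" by simp
    qed
    finally have g: "Const s * branch_map s g = (\<Prod>t\<in>T. zc s t)"
      by (simp add: 0)
    have "branch_map s f + Const (- s) * branch_map s g = (\<Prod>t\<in>T. ?h (X t) + Const (- s) * ?h (Y t))"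
      unfolding branch_map_def by (rule fg(2)) (simp add: s)
    also have "\<dots> = (\<Prod>t\<in>T. 0)"
    proof (rule prod.cong[OF refl])
      fix t
      have "?h (X t) + Const (- s) * ?h (Y t) = (Const (1 / 2) + Const (- s * (- s / 2))) * zc s t"
        by (simp only: lss_var.case Const_mult ring_distribs mult.assoc)
      also have "Const (1 / 2) + Const (- s * (- s / 2)) = (0 :: (lss_var, complex) mpoly)"
        by (simp add: s flip: single_add)
      finally show "?h (X t) + Const (- s) * ?h (Y t) = 0" by simp
    qed
    also have "\<dots> = 0"
      using fin \<open>T \<noteq> {}\<close> by (simp add: card_gt_0_iff)
    finally have "Const s * branch_map s g = 0"
      by (simp add: 0 single_uminus)
    with g show False
      using fin zc_nonzero by simp
  qed
  have "colon_ideal (lss_ring n) (lss_ideal n G) f = I_K n"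
  proof
    show "I_K n \<subseteq> colon_ideal (lss_ring n) (lss_ideal n G) f"
      using sub additive_subgroup.a_subset[OF ideal.axioms(1)[OF ideal_I_K, of n]]
      by (auto simp: colon_ideal_def lss_ring_def L_eq simp del: poly_ring_simps(1))
    show "colon_ideal (lss_ring n) (lss_ideal n G) f \<subseteq> I_K n"
    proof
      fix p assume "p \<in> colon_ideal (lss_ring n) (lss_ideal n G) f"
      then have p: "p \<in> carrier ?R" "p * f \<in> L"
        by (simp_all add: colon_ideal_def lss_ring_def L_eq del: poly_ring_simps(1))
      \<comment> \<open>The images of \<open>p\<close> and \<open>f\<close> multiply to zero in an
        integral domain, and that of \<open>f\<close> is nonzero.\<close>
      have "branch_map s p = 0" if "s * s = - 1" for s
        using branch_L[OF that p(2)] f_nz[OF that] by simp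
      then show "p \<in> I_K n"
        using I_K_memI[of \<i> p n] p(1) by simp
    qed
  qed
  then have "v_number (lss_ring n) (I_K n) (lss_ideal n G) \<le> enat (card T)"
    unfolding v_number_def using fg(1) by (intro INF_lower) (auto simp: lss_ring_def)
  then show ?thesis
    by (simp add: T(1))
qed

end
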